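(* There exist constants $A_0$ and $\rho_0>0$ such that for all real $\alpha$ and all positive reals $R,Q$ with $\operatorname{area}(\Sigma(\alpha,R,Q))\ge A_0$, $$\operatorname{Spec}(\alpha)\cap[Q,R]\neq\emptyset\quad\Longrightarrow\quad \operatorname{dens}(\Sigma(\alpha,R,Q))\ge\rho_0.$$
   Context: $\Sigma(\alpha,R,Q)$ is the parallelogram $$\Sigma(\alpha,R,Q)=\{(x,y)\in\mathbb R^2: |y\alpha-x|\le 1/Q,\ R\le y\le 2R\}.$$ Its arithmetic density is $$\operatorname{dens}(\Sigma)=\frac{\#\{(p,q)\in\Sigma\cap\mathbb Z^2:\gcd(p,q)=1\}}{\operatorname{area}(\Sigma)}.$$ The height of a rational is its denominator $q>0$ in lowest terms. $\operatorname{Spec}(\alpha)$ is the sequence (regarded as a set) of heights $q_k$ of the continued fraction convergents $p_k/q_k$ of $\alpha$. *)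

theory Defs
  imports "HOL-Analysis.Analysis"
begin

definition parallelogram :: "real \<Rightarrow> real \<Rightarrow> real \<Rightarrow> (real \<times> real) set" where
  "parallelogram \<alpha> R Q = {(x, y). \<bar>y * \<alpha> - x\<bar> \<le> 1 / Q \<and> R \<le> y \<and> y \<le> 2 * R}"

definition area :: "(real \<times> real) set \<Rightarrow> real" where
  "area S = measure lborel S"

definition dens :: "(real \<times> real) set \<Rightarrow> real" where
  "dens S = real (card {(p :: int, q :: int). (of_int p, of_int q) \<in> S \<and> gcd p q = 1}) / area S"

definition height :: "rat \<Rightarrow> int" where
  "height r = snd (quotient_of r)"

(* Complete quotients. For rational alpha the expansion stops at the first integral complete
   quotient; the values after that (junk from 1 / 0 = 0) are excluded by cf_index below. *)
fun complete_quot :: "real \<Rightarrow> nat \<Rightarrow> real" where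
  "complete_quot \<alpha> 0 = \<alpha>"
| "complete_quot \<alpha> (Suc k) = 1 / frac (complete_quot \<alpha> k)"

definition partial_quot :: "real \<Rightarrow> nat \<Rightarrow> int" where
  "partial_quot \<alpha> k = \<lfloor>complete_quot \<alpha> k\<rfloor>"

(* The k-th partial quotient exists. If a rational non-integral alpha has the finite expansion
   [a_0; ..., a_n], then this is the expansion with a_n >= 2. *)
definition cf_index :: "real \<Rightarrow> nat \<Rightarrow> bool" where
  "cf_index \<alpha> k \<longleftrightarrow> (\<forall>j<k. complete_quot \<alpha> j \<notin> \<int>)"

fun cf_num :: "real \<Rightarrow> nat \<Rightarrow> int" where
  "cf_num \<alpha> 0 = partial_quot \<alpha> 0"
| "cf_num \<alpha> (Suc 0) = partial_quot \<alpha> 1 * partial_quot \<alpha> 0 + 1"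
| "cf_num \<alpha> (Suc (Suc k)) = partial_quot \<alpha> (Suc (Suc k)) * cf_num \<alpha> (Suc k) + cf_num \<alpha> k"

fun cf_den :: "real \<Rightarrow> nat \<Rightarrow> int" where
  "cf_den \<alpha> 0 = 1"
| "cf_den \<alpha> (Suc 0) = partial_quot \<alpha> 1"
| "cf_den \<alpha> (Suc (Suc k)) = partial_quot \<alpha> (Suc (Suc k)) * cf_den \<alpha> (Suc k) + cf_den \<alpha> k"

definition convergent_of :: "real \<Rightarrow> nat \<Rightarrow> rat" where
  "convergent_of \<alpha> k = of_int (cf_num \<alpha> k) / of_int (cf_den \<alpha> k)"

definition Spec :: "real \<Rightarrow> int set" where
  "Spec \<alpha> = {height (convergent_of \<alpha> k) | k. cf_index \<alpha> k}"

lemma partial_quot_ge_1: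
  assumes "cf_index \<alpha> k" "0 < k"
  shows "1 \<le> partial_quot \<alpha> k"
proof -
  obtain j where j: "k = Suc j" using assms(2) by (cases k) auto
  have "complete_quot \<alpha> j \<notin> \<int>" using assms(1) j by (auto simp: cf_index_def)
  hence "0 < frac (complete_quot \<alpha> j)" by (simp add: frac_gt_0_iff)
  moreover have "frac (complete_quot \<alpha> j) < 1" by (rule frac_lt_1)
  ultimately have "1 \<le> complete_quot \<alpha> k" by (simp add: j)
  thus ?thesis by (simp add: partial_quot_def le_floor_iff)
qed

lemma cf_index_mono: "cf_index \<alpha> k \<Longrightarrow> j \<le> k \<Longrightarrow> cf_index \<alpha> j"
  by (auto simp: cf_index_def)

lemma cf_den_pos: "cf_index \<alpha> k \<Longrightarrow> 0 < cf_den \<alpha> k"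
proof (induction \<alpha> k rule: cf_den.induct)
  case (2 \<alpha>)
  thus ?case using partial_quot_ge_1[of \<alpha> 1] by simp
next
  case (3 \<alpha> k)
  have "0 < cf_den \<alpha> (Suc k)" "0 < cf_den \<alpha> k"
    using 3 cf_index_mono[OF "3.prems"] by auto
  thus ?case using partial_quot_ge_1[OF "3.prems"] by (simp add: add_pos_pos)
qed simp

lemma cf_det:
  "cf_num \<alpha> (Suc k) * cf_den \<alpha> k - cf_num \<alpha> k * cf_den \<alpha> (Suc k) = (-1) ^ k"
  by (induction k) (simp_all add: algebra_simps)

lemma coprime_cf_num_cf_den: "coprime (cf_num \<alpha> k) (cf_den \<alpha> k)"
proof (rule coprimeI)
  fix d assume d: "d dvd cf_num \<alpha> k" "d dvd cf_den \<alpha> k"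
  have "d dvd cf_num \<alpha> (Suc k) * cf_den \<alpha> k - cf_num \<alpha> k * cf_den \<alpha> (Suc k)"
    using d by (intro dvd_diff) auto
  hence "d dvd (-1) ^ k" by (simp only: cf_det)
  thus "is_unit d" by (metis dvd_trans dvd_refl minus_one_power_iff dvd_minus_iff)
qed

lemma height_convergent_of:
  "cf_index \<alpha> k \<Longrightarrow> height (convergent_of \<alpha> k) = cf_den \<alpha> k"
  using cf_den_pos[of \<alpha> k] coprime_cf_num_cf_den[of \<alpha> k]
  by (simp add: height_def convergent_of_def Fract_of_int_quotient[symmetric] quotient_of_Fract
      normalize_def)

end

theory Submission
  imports Defs "HOL-Analysis.Kronecker_Approximation_Theorem"
begin

text \<open>
  Write $e(p,q) = q\alpha - p$. The parallelogram $\Sigma$ asks for $|e| \le 1/Q$ and $R \le q \le 2R$ and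
  has area $2R/Q$, so in the coordinates $s = Qe$, $t = q/R$ it becomes a fixed rectangle and
  $\mathbb{Z}^2$ becomes a lattice of covolume $\delta = Q/R$, which is small once the area is large.

  Dirichlet's theorem gives a primitive lattice vector $u$ of length $O(\sqrt\delta)$
  (\<open>exists_short_primitive_vector\<close>). The lattice lies on equally spaced lines parallel to $u$, and the
  $a$-th line consists of the points $aw + bu$, where $(u,w)$ is a basis. Such a point is primitive iff
  $\gcd(a,b) = 1$. The gap between neighbouring lines is about $\delta/|u|$. So $\Sigma$ is
  well filled by lines as soon as $|u|$ is not much shorter than $\delta$; then the lines with index $a$ in some
  $[X,2X]$ each meet $\Sigma$ in a segment that contains about $L$ consecutive values of $b$, where
  $XL$ is proportional to the area and $X = O(L)$ because $|u| = O(\sqrt\delta)$.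

  The condition on $\alpha$ excludes the bad case $|u| \ll \delta$, in which a single line could carry
  all lattice points near $\Sigma$. Let $q_k$ be the height of a convergent with $Q \le q_k \le R$ and let $u = (p,q)$.
  Either $q \ge q_k \ge Q$, which means $t \ge \delta$, or $q < q_k$, and then the best
  approximation property gives $|e(p,q)| \ge 1/(2q_k) \ge 1/(2R)$, which means $|s| \ge \delta/2$
  (\<open>approximation_error_ge_below_convergent\<close>). Depending on which coordinate of $u$ dominates, the
  lines are followed in the direction of $t$ (\<open>dens_ge_steep_direction\<close>) or in the direction of $s$
  (\<open>dens_ge_flat_direction\<close>).

  It remains to see that a positive proportion of the pairs $(a,b)$ is coprime, although the interval
  for $b$ depends on $a$ in an arbitrary way (\<open>card_coprime_pairs_ge\<close>). Sieving each interval by the primes dividing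
  $a$ loses at most the proportion $\sum_{p \mid a} 1/p$ up to $O(\sqrt L)$ terms. On average over
  $a \in [X,2X]$ this sum is at most $2\sum_p p^{-2}$, since $a \le 2X$ and there are about $X$ values $a$;
  and $\sum_p p^{-2} < 1/2$.
\<close>

section \<open>Coprime pairs in a stack of intervals\<close>

text \<open>
  The summand is at most $\frac14\left(\frac1j - \frac1{j+1}\right)$, so the sum telescopes.
\<close>

lemma sum_inverse_odd_squares_le:
  "(\<Sum>j=3..n. 1 / (2 * real j + 1)\<^sup>2) \<le> 1 / 12"
proof -
  have tel: "(\<Sum>j=3..n. 1 / (2 * real j + 1)\<^sup>2) \<le> 1 / 12 - 1 / (4 * (real n + 1))" if "n \<ge> 2"
    using that
  proof (induction n rule: dec_induct)
    case (step n)
    have "1 / (2 * real (Suc n) + 1)\<^sup>2 \<le> 1 / (4 * (real n + 1) * (real n + 2))"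
      by (intro divide_left_mono) (auto simp: power2_eq_square algebra_simps add_pos_nonneg)
    also have "\<dots> = 1 / (4 * (real n + 1)) - 1 / (4 * (real (Suc n) + 1))"
      by (simp add: divide_simps)
    finally show ?case using step by simp
  qed simp
  have "1 / (4 * (real n + 1)) \<ge> 0" by simp
  show ?thesis
  proof (cases "n \<ge> 2")
    case True
    show ?thesis using tel[OF True] \<open>1 / (4 * (real n + 1)) \<ge> 0\<close> by linarith
  qed simp
qed

text \<open>
  The value that matters is that the bound is below $1/2$. Bounding all odd squares from $9$ on by telescoping would
  give exactly $1/2$; treating $2, 3, 5$ separately and telescoping only over $7, 9, 11, \ldots$
  gives $\frac14 + \frac19 + \frac1{25} + \frac1{12} = \frac{109}{225}$.
\<close>

lemma sum_inverse_prime_squares_le: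
  "(\<Sum>p | prime p \<and> p \<le> M. 1 / (of_int p :: real)\<^sup>2) \<le> 109 / 225" for M :: int
proof -
  let ?f = "\<lambda>p :: int. 1 / (of_int p :: real)\<^sup>2"
  let ?g = "\<lambda>j :: nat. 2 * int j + 1"
  have fin: "finite ({2, 3, 5} \<union> ?g ` {3..nat M})" by simp
  have sub: "{p. prime p \<and> p \<le> M} \<subseteq> {2, 3, 5} \<union> ?g ` {3..nat M}"
  proof
    fix p :: int assume "p \<in> {p. prime p \<and> p \<le> M}"
    hence p: "prime p" "p \<le> M" by auto
    have p2: "p \<ge> 2" using p(1) by (rule prime_ge_2_int)
    show "p \<in> {2, 3, 5} \<union> ?g ` {3..nat M}"
    proof (cases "p \<in> {2, 3, 5}")
      case False
      have "odd p" using p(1) False p2 primes_dvd_imp_eq[of 2 p] by auto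
      then obtain j where j: "p = 2 * j + 1" by (elim oddE)
      have "j \<ge> 3" using j False p2 by auto
      hence "p = ?g (nat j)" "nat j \<in> {3..nat M}" using j p by auto
      thus ?thesis by blast
    qed auto
  qed
  have "(\<Sum>p | prime p \<and> p \<le> M. ?f p) \<le> sum ?f ({2, 3, 5} \<union> ?g ` {3..nat M})"
    by (rule sum_mono2[OF fin sub]) simp
  also have "\<dots> \<le> sum ?f {2, 3, 5} + sum ?f (?g ` {3..nat M})"
    by (subst sum_Un) (auto intro: sum_nonneg)
  also have "sum ?f (?g ` {3..nat M}) = (\<Sum>j=3..nat M. 1 / (2 * real j + 1)\<^sup>2)"
    by (subst sum.reindex) (auto simp: inj_on_def)
  also have "\<dots> \<le> 1 / 12" by (rule sum_inverse_odd_squares_le)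
  finally show ?thesis by (simp add: power2_eq_square)
qed

lemma card_ints_between:
  fixes x y :: real assumes "x \<le> y"
  shows "finite {k :: int. x \<le> of_int k \<and> of_int k \<le> y}"
    and "real (card {k :: int. x \<le> of_int k \<and> of_int k \<le> y}) \<le> y - x + 1"
    and "real (card {k :: int. x \<le> of_int k \<and> of_int k \<le> y}) \<ge> y - x - 1"
proof -
  have eq: "{k :: int. x \<le> of_int k \<and> of_int k \<le> y} = {\<lceil>x\<rceil>..\<lfloor>y\<rfloor>}"
    by (auto simp: ceiling_le_iff le_floor_iff)
  show "finite {k :: int. x \<le> of_int k \<and> of_int k \<le> y}" unfolding eq by simp
  have "\<lfloor>y\<rfloor> - \<lceil>x\<rceil> + 1 \<ge> 0" using assms by linarith
  hence "real (card {\<lceil>x\<rceil>..\<lfloor>y\<rfloor>}) = of_int (\<lfloor>y\<rfloor> - \<lceil>x\<rceil> + 1)" by simp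
  moreover have "of_int (\<lfloor>y\<rfloor> - \<lceil>x\<rceil> + 1) \<le> y - x + (1 :: real)"
    "of_int (\<lfloor>y\<rfloor> - \<lceil>x\<rceil> + 1) \<ge> y - x - (1 :: real)" by linarith+
  ultimately show "real (card {k :: int. x \<le> of_int k \<and> of_int k \<le> y}) \<le> y - x + 1"
    "real (card {k :: int. x \<le> of_int k \<and> of_int k \<le> y}) \<ge> y - x - 1" unfolding eq by simp_all
qed

lemma card_multiples_between_le:
  fixes x y :: real and p :: int assumes "x \<le> y" "p > 0"
  shows "real (card {b. x \<le> of_int b \<and> of_int b \<le> y \<and> p dvd b}) \<le> (y - x) / of_int p + 1"
proof -
  let ?K = "{k :: int. x / of_int p \<le> of_int k \<and> of_int k \<le> y / of_int p}"
  have le: "x / of_int p \<le> y / of_int p" using assms by (simp add: divide_right_mono)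
  have sub: "{b. x \<le> of_int b \<and> of_int b \<le> y \<and> p dvd b} \<subseteq> (\<lambda>k. p * k) ` ?K"
    using assms(2) by (auto simp: dvd_def field_simps)
  have "card {b. x \<le> of_int b \<and> of_int b \<le> y \<and> p dvd b} \<le> card ((\<lambda>k. p * k) ` ?K)"
    by (rule card_mono[OF _ sub]) (use card_ints_between(1)[OF le] in simp)
  also have "\<dots> \<le> card ?K" by (rule card_image_le[OF card_ints_between(1)[OF le]])
  finally show ?thesis using card_ints_between(2)[OF le] assms(2)
    by (simp add: diff_divide_distrib)
qed

text \<open>
  Unlike for a general interval there is no additive error $+1$, because the counting starts at $1$. This
  is what keeps the sum over all primes in the sieve convergent.
\<close>

lemma card_multiples_upto_le:
  fixes M p :: int assumes "p > 0" "M \<ge> 0" "S \<subseteq> {1..M}"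
  shows "real (card {a \<in> S. p dvd a}) \<le> of_int M / of_int p"
proof -
  have sub: "{a \<in> S. p dvd a} \<subseteq> (\<lambda>k. p * k) ` {1..M div p}"
  proof
    fix a assume "a \<in> {a \<in> S. p dvd a}"
    then obtain k where k: "a = p * k" "1 \<le> a" "a \<le> M"
      using assms(3) by (auto simp: subset_iff elim!: dvdE)
    have "k \<ge> 1" using k assms(1) by (simp add: int_one_le_iff_zero_less zero_less_mult_iff)
    moreover have "k \<le> M div p" using k assms(1) zdiv_mono1[of a M p] by simp
    ultimately show "a \<in> (\<lambda>k. p * k) ` {1..M div p}" using k by auto
  qed
  have "card {a \<in> S. p dvd a} \<le> card ((\<lambda>k. p * k) ` {1..M div p})"
    by (rule card_mono[OF _ sub]) simp
  also have "\<dots> \<le> nat (M div p)" using card_image_le[of "{1..M div p}"] by simp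
  finally have "card {a \<in> S. p dvd a} \<le> nat (M div p)" .
  moreover have "M div p \<ge> 0" using assms by (simp add: pos_imp_zdiv_nonneg_iff)
  ultimately have "real (card {a \<in> S. p dvd a}) \<le> of_int (M div p)" by linarith
  also have "\<dots> \<le> of_int M / of_int p" by (rule real_of_int_div4)
  finally show ?thesis .
qed

lemma square_le_twice_power2: "n\<^sup>2 \<le> 2 * 2 ^ n" for n :: nat
proof (cases "n \<ge> 3")
  case True
  thus ?thesis
  proof (induction n rule: dec_induct)
    case (step n)
    have "3 * n \<le> n * n" using step(1) by simp
    hence "2 * n + 1 \<le> n\<^sup>2" using step(1) unfolding power2_eq_square by linarith
    hence "(Suc n)\<^sup>2 \<le> 2 * n\<^sup>2" by (simp add: power2_eq_square)
    thus ?case using step by simp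
  qed simp
next
  case False
  hence "n = 0 \<or> n = 1 \<or> n = 2" by auto
  thus ?thesis by auto
qed

text \<open>
  With $n$ distinct prime divisors, $2^n$ is at most their product, hence at most $a$.
  A polynomial bound in $n$ suffices below, so $2^n \ge n^2/2$ is used instead of a logarithm.
\<close>

lemma card_prime_divisors_squared_le:
  fixes a :: int assumes "a > 0"
  shows "finite {p. prime p \<and> p dvd a}" "real (card {p. prime p \<and> p dvd a}) ^ 2 \<le> 2 * of_int a"
proof -
  let ?S = "{p. prime p \<and> p dvd a}"
  have S: "?S = prime_factors a" using assms by (auto simp: prime_factors_dvd)
  thus fin: "finite ?S" by simp
  have "\<Prod>F dvd a" if "F \<subseteq> ?S" for F
    using finite_subset[OF that fin] that
  proof (induction F rule: finite_induct)
    case (insert p F)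
    have "coprime p (\<Prod>F)"
      using insert by (intro prod_coprime_right) (auto intro!: primes_coprime)
    thus ?case using insert by (simp add: divides_mult)
  qed simp
  hence "\<Prod>?S dvd a" by blast
  hence "\<Prod>?S \<le> a" using assms by (simp add: zdvd_imp_le)
  moreover have "(2 :: int) ^ card ?S \<le> \<Prod>?S"
  proof -
    have "(\<Prod>p\<in>?S. 2 :: int) \<le> \<Prod>?S" by (intro prod_mono) (auto intro: prime_ge_2_int)
    thus ?thesis by simp
  qed
  ultimately have "(2 :: int) ^ card ?S \<le> a" by linarith
  hence "(2 :: real) ^ card ?S \<le> of_int a"
    by (metis of_int_le_iff of_int_numeral of_int_power)
  moreover have "real ((card ?S)\<^sup>2) \<le> real (2 * 2 ^ card ?S)"
    using square_le_twice_power2 of_nat_le_iff by blast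
  hence "real (card ?S) ^ 2 \<le> 2 * 2 ^ card ?S" by simp
  ultimately show "real (card ?S) ^ 2 \<le> 2 * of_int a" by linarith
qed

text \<open>
  For large $X$ the interval $[X,2X]$ holds about half of the integers up to $2X$. That this
  stays true with the exact constant down to $X = 1/2$ allows a lattice with only one line crossing $\Sigma$.
\<close>

lemma card_doubling_interval_ge:
  fixes X :: real assumes "X \<ge> 1 / 2"
  shows "of_int \<lfloor>2 * X\<rfloor> \<le> 2 * real (card {a :: int. X \<le> of_int a \<and> of_int a \<le> 2 * X})"
    and "X \<le> of_int \<lfloor>2 * X\<rfloor>"
proof -
  have eq: "{a :: int. X \<le> of_int a \<and> of_int a \<le> 2 * X} = {\<lceil>X\<rceil>..\<lfloor>2 * X\<rfloor>}"
    by (auto simp: ceiling_le_iff le_floor_iff)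
  have "2 * \<lceil>X\<rceil> - 2 \<le> \<lfloor>2 * X\<rfloor>" "\<lceil>X\<rceil> \<ge> 1" using assms by linarith+
  thus "of_int \<lfloor>2 * X\<rfloor> \<le> 2 * real (card {a :: int. X \<le> of_int a \<and> of_int a \<le> 2 * X})"
    unfolding eq by simp
  have "\<lfloor>2 * X\<rfloor> \<ge> 1" using assms by linarith
  hence "(1 :: real) \<le> of_int \<lfloor>2 * X\<rfloor>" by linarith
  moreover have "2 * X - 1 < of_int \<lfloor>2 * X\<rfloor>" by linarith
  ultimately show "X \<le> of_int \<lfloor>2 * X\<rfloor>" by linarith
qed

text \<open>
  An integer that is not coprime to $a$ is a multiple of a prime divisor of $a$, and each such prime $p$
  removes at most $L/p + 1$ of the at least $L - 1$ integers.
\<close>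

lemma card_coprime_in_interval_ge:
  fixes x L :: real and a :: int
  assumes "a > 0" "L \<ge> 0"
  shows "L - 1 - real (card {p. prime p \<and> p dvd a}) - L * (\<Sum>p | prime p \<and> p dvd a. 1 / of_int p)
    \<le> real (card {b. x \<le> of_int b \<and> of_int b \<le> x + L \<and> coprime a b})"
proof -
  let ?D = "{p. prime p \<and> p dvd a}"
  let ?I = "{b :: int. x \<le> of_int b \<and> of_int b \<le> x + L}"
  let ?G = "{b. x \<le> of_int b \<and> of_int b \<le> x + L \<and> coprime a b}"
  let ?B = "\<lambda>p. {b. x \<le> of_int b \<and> of_int b \<le> x + L \<and> p dvd b}"
  have xL: "x \<le> x + L" using assms by simp
  have finI: "finite ?I" by (rule card_ints_between(1)[OF xL])
  have finD: "finite ?D" by (rule card_prime_divisors_squared_le(1)[OF assms(1)])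
  have sub: "?I \<subseteq> ?G \<union> (\<Union>p\<in>?D. ?B p)"
  proof
    fix b assume b: "b \<in> ?I"
    show "b \<in> ?G \<union> (\<Union>p\<in>?D. ?B p)"
    proof (cases "coprime a b")
      case False
      hence "gcd a b \<noteq> 1" by (simp add: coprime_iff_gcd_eq_1)
      moreover have "gcd a b \<noteq> 0" using assms by simp
      ultimately obtain p where "prime p" "p dvd gcd a b"
        using prime_divisor_exists[of "gcd a b"] by auto
      thus ?thesis using b by auto
    qed (use b in auto)
  qed
  have "card ?I \<le> card (?G \<union> (\<Union>p\<in>?D. ?B p))"
    by (rule card_mono[OF _ sub]) (use finI finD in \<open>auto intro: finite_subset[OF _ finI]\<close>)
  also have "\<dots> \<le> card ?G + (\<Sum>p\<in>?D. card (?B p))"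
    by (rule order.trans[OF card_Un_le]) (simp add: card_UN_le finD)
  finally have "real (card ?I) \<le> real (card ?G) + (\<Sum>p\<in>?D. real (card (?B p)))"
    by (simp flip: of_nat_sum of_nat_add)
  also have "(\<Sum>p\<in>?D. real (card (?B p))) \<le> (\<Sum>p\<in>?D. L / of_int p + 1)"
  proof (rule sum_mono)
    fix p assume "p \<in> ?D"
    hence "p > 0" by (auto intro: prime_gt_0_int)
    thus "real (card (?B p)) \<le> L / of_int p + 1"
      using card_multiples_between_le[OF xL, of p] by simp
  qed
  also have "\<dots> = L * (\<Sum>p\<in>?D. 1 / of_int p) + real (card ?D)"
    by (simp add: sum.distrib sum_distrib_left)
  finally show ?thesis using card_ints_between(3)[OF xL] by simp
qed

text \<open>
  The upper bound on $X$ makes the number of prime divisors of $a$ of size $O(\sqrt L)$, negligible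
  against $L$ when $L$ is large. The remaining loss is averaged over $a$ by exchanging
  the sums over $a$ and $p$.
\<close>

lemma card_coprime_pairs_ge:
  fixes X L :: real and c :: "int \<Rightarrow> real"
  assumes X: "1 / 2 \<le> X" "X \<le> 16 * L" and L: "L \<ge> 202500"
  shows "X * L / 200 \<le> real (card {(a :: int, b :: int). X \<le> of_int a \<and> of_int a \<le> 2 * X \<and>
    c a \<le> of_int b \<and> of_int b \<le> c a + L \<and> coprime a b})"
proof -
  define J where "J = {a :: int. X \<le> of_int a \<and> of_int a \<le> 2 * X}"
  define M where "M = \<lfloor>2 * X\<rfloor>"
  define D where "D = (\<lambda>a :: int. {p. prime p \<and> p dvd a})"
  define P where "P = {p :: int. prime p \<and> p \<le> M}"
  define G where "G = (\<lambda>a. {b. c a \<le> of_int b \<and> of_int b \<le> c a + L \<and> coprime a b})"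
  have J1: "a \<ge> 1" "a \<le> M" if "a \<in> J" for a
  proof -
    have "0 < real_of_int a" using that X(1) by (simp add: J_def)
    thus "a \<ge> 1" by simp
    show "a \<le> M" using that by (simp add: J_def M_def le_floor_iff)
  qed
  hence subJ: "J \<subseteq> {1..M}" by auto
  have finJ: "finite J" by (rule finite_subset[OF subJ]) simp
  have finP: "finite P"
    by (rule finite_subset[of _ "{0..M}"]) (auto simp: P_def prime_ge_0_int)
  have finG: "finite (G a)" for a
    using L by (intro finite_subset[OF _ card_ints_between(1)[of "c a" "c a + L"]]) (auto simp: G_def)
  have M0: "M \<ge> 0" using X(1) by (simp add: M_def le_floor_iff)

  have G: "49 / 50 * L - L * (\<Sum>p\<in>D a. 1 / of_int p) \<le> real (card (G a))" if a: "a \<in> J" for a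
  proof -
    have "real (card (D a)) ^ 2 \<le> 2 * of_int a"
      using card_prime_divisors_squared_le(2)[of a] J1(1)[OF a] by (simp add: D_def)
    also have "\<dots> \<le> 64 * L" using a X by (simp add: J_def)
    also have "\<dots> = (8 * sqrt L)\<^sup>2" using L by (simp add: power_mult_distrib)
    finally have "real (card (D a)) \<le> 8 * sqrt L"
      by (rule power2_le_imp_le) (use L in simp)
    \<comment> \<open>The lower bound on \<open>L\<close> is $450^2$, so that $1 + 8\sqrt L \le 9 \sqrt L \le L/50$.\<close>
    moreover have r: "450 \<le> sqrt L" using L by (intro real_le_rsqrt) simp
    moreover have "450 * sqrt L \<le> L"
      using mult_right_mono[OF r, of "sqrt L"] L by simp
    ultimately have "1 + real (card (D a)) \<le> L / 50" by linarith
    thus ?thesis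
      using card_coprime_in_interval_ge[of a L "c a"] J1(1)[OF a] L
      unfolding D_def G_def by simp
  qed

  have "(\<Sum>a\<in>J. \<Sum>p\<in>D a. 1 / real_of_int p) = (\<Sum>a\<in>J. \<Sum>p | p \<in> P \<and> p dvd a. 1 / real_of_int p)"
  proof (rule sum.cong[OF refl])
    fix a assume a: "a \<in> J"
    have "D a = {p \<in> P. p dvd a}"
      using J1[OF a] by (auto simp: D_def P_def dest: zdvd_imp_le)
    thus "(\<Sum>p\<in>D a. 1 / real_of_int p) = (\<Sum>p | p \<in> P \<and> p dvd a. 1 / real_of_int p)" by simp
  qed
  also have "\<dots> = (\<Sum>p\<in>P. \<Sum>a | a \<in> J \<and> p dvd a. 1 / real_of_int p)"
    by (rule sum.swap_restrict[OF finJ finP])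
  also have "\<dots> \<le> (\<Sum>p\<in>P. of_int M * (1 / (of_int p)\<^sup>2))"
  proof (rule sum_mono)
    fix p assume "p \<in> P"
    hence p: "p > 0" by (auto simp: P_def intro: prime_gt_0_int)
    have "(\<Sum>a | a \<in> J \<and> p dvd a. 1 / real_of_int p) = real (card {a \<in> J. p dvd a}) / of_int p" by simp
    also have "\<dots> \<le> of_int M / of_int p / of_int p"
      using card_multiples_upto_le[OF p M0 subJ] p by (intro divide_right_mono) auto
    finally show "(\<Sum>a | a \<in> J \<and> p dvd a. 1 / real_of_int p) \<le> of_int M * (1 / (of_int p)\<^sup>2)"
      by (simp add: power2_eq_square)
  qed
  also have "\<dots> = of_int M * (\<Sum>p\<in>P. 1 / (of_int p)\<^sup>2)" by (simp add: sum_distrib_left)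
  also have "\<dots> \<le> of_int M * (109 / 225)"
    using M0 sum_inverse_prime_squares_le[of M] by (intro mult_left_mono) (auto simp: P_def)
  also have "\<dots> \<le> 218 / 225 * real (card J)"
    using card_doubling_interval_ge(1)[OF X(1)] by (simp add: M_def J_def)
  finally have "L * (\<Sum>a\<in>J. \<Sum>p\<in>D a. 1 / real_of_int p) \<le> L * (218 / 225 * real (card J))"
    using L by (intro mult_left_mono) auto
  hence "real (card J) * (49 / 50 * L) - L * (218 / 225 * real (card J))
      \<le> (\<Sum>a\<in>J. 49 / 50 * L - L * (\<Sum>p\<in>D a. 1 / of_int p))"
    by (simp add: sum_subtractf sum_distrib_left)
  also have "\<dots> \<le> (\<Sum>a\<in>J. real (card (G a)))" by (rule sum_mono) (rule G)
  also have "\<dots> = real (card (Sigma J G))" using finJ finG by (simp add: card_SigmaI)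
  \<comment> \<open>The proportion that survives is $49/50 - 218/225 = 1/90$.\<close>
  finally have main: "real (card J) * L * (1 / 90) \<le> real (card (Sigma J G))" by (simp add: algebra_simps)
  have "X / 2 \<le> real (card J)"
    using card_doubling_interval_ge[OF X(1)] by (simp add: J_def)
  hence "X / 2 * L \<le> real (card J) * L" using L by (intro mult_right_mono) auto
  moreover have "0 \<le> X * L" using X L by simp
  ultimately have "X * L / 200 \<le> real (card (Sigma J G))" using main by linarith
  also have "Sigma J G = {(a, b). X \<le> of_int a \<and> of_int a \<le> 2 * X \<and>
      c a \<le> of_int b \<and> of_int b \<le> c a + L \<and> coprime a b}"
    by (auto simp: J_def G_def)
  finally show ?thesis .
qed

section \<open>Area and lattice points of the parallelogram\<close>

lemma sets_parallelogram: "parallelogram \<alpha> R Q \<in> sets borel"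
proof -
  have "closed {z :: real \<times> real. \<bar>snd z * \<alpha> - fst z\<bar> \<le> 1 / Q \<and> R \<le> snd z \<and> snd z \<le> 2 * R}"
    by (intro closed_Collect_conj closed_Collect_le continuous_intros)
  moreover have "parallelogram \<alpha> R Q =
      {z. \<bar>snd z * \<alpha> - fst z\<bar> \<le> 1 / Q \<and> R \<le> snd z \<and> snd z \<le> 2 * R}"
    by (auto simp: parallelogram_def)
  ultimately show ?thesis by (simp add: borel_closed)
qed

lemma area_parallelogram:
  assumes "R > 0" "Q > 0"
  shows "area (parallelogram \<alpha> R Q) = 2 * R / Q"
proof -
  have section_eq: "emeasure lborel ((\<lambda>x. (x, y)) -` parallelogram \<alpha> R Q)
      = ennreal (2 / Q) * indicator {R..2 * R} y" for y
  proof (cases "y \<in> {R..2 * R}")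
    case True
    have "(\<lambda>x. (x, y)) -` parallelogram \<alpha> R Q = {y * \<alpha> - 1 / Q..y * \<alpha> + 1 / Q}"
      using True by (auto simp: parallelogram_def abs_le_iff)
    thus ?thesis using True assms by simp
  next
    case False
    hence "(\<lambda>x. (x, y)) -` parallelogram \<alpha> R Q = {}" by (auto simp: parallelogram_def)
    thus ?thesis using False by simp
  qed
  have "emeasure lborel (parallelogram \<alpha> R Q)
      = emeasure (lborel \<Otimes>\<^sub>M lborel) (parallelogram \<alpha> R Q)" by (simp add: lborel_prod)
  also have "\<dots> = (\<integral>\<^sup>+ y. emeasure lborel ((\<lambda>x. (x, y)) -` parallelogram \<alpha> R Q) \<partial>lborel)"
    using sets_parallelogram[of \<alpha> R Q]
    by (intro lborel_pair.emeasure_pair_measure_alt2) (simp only: lborel_prod sets_lborel)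
  also have "\<dots> = ennreal (2 / Q) * emeasure lborel {R..2 * R}"
    unfolding section_eq by (rule nn_integral_cmult_indicator) simp
  also have "\<dots> = ennreal (2 * R / Q)" using assms by (simp flip: ennreal_mult)
  finally show ?thesis using assms by (simp add: area_def measure_def)
qed

lemma finite_lattice_points_parallelogram:
  "finite {(p :: int, q :: int). (of_int p, of_int q) \<in> parallelogram \<alpha> R Q \<and> gcd p q = 1}"
proof (rule finite_subset)
  let ?B = "\<lceil>2 * \<bar>R\<bar>\<rceil>" and ?C = "\<lceil>2 * \<bar>R\<bar> * \<bar>\<alpha>\<bar> + 1 / Q\<rceil>"
  show "finite ({- ?C..?C} \<times> {- ?B..?B})" by simp
  show "{(p :: int, q :: int). (of_int p, of_int q) \<in> parallelogram \<alpha> R Q \<and> gcd p q = 1}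
      \<subseteq> {- ?C..?C} \<times> {- ?B..?B}"
  proof clarify
    fix p q :: int assume pq: "(of_int p, of_int q) \<in> parallelogram \<alpha> R Q"
    hence q: "\<bar>real_of_int q\<bar> \<le> 2 * \<bar>R\<bar>" by (auto simp: parallelogram_def)
    have "\<bar>real_of_int q * \<alpha>\<bar> \<le> 2 * \<bar>R\<bar> * \<bar>\<alpha>\<bar>"
      using q by (simp add: abs_mult mult_right_mono)
    hence p: "\<bar>real_of_int p\<bar> \<le> 2 * \<bar>R\<bar> * \<bar>\<alpha>\<bar> + 1 / Q"
      using pq by (auto simp: parallelogram_def)
    show "p \<in> {- ?C..?C} \<and> q \<in> {- ?B..?B}" using p q by (auto; linarith)
  qed
qed

section \<open>Convergents are best approximations\<close>

definition cf_err :: "real \<Rightarrow> nat \<Rightarrow> real" where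
  "cf_err \<alpha> k = of_int (cf_den \<alpha> k) * \<alpha> - of_int (cf_num \<alpha> k)"

text \<open>
  Consecutive errors alternate in sign and do not increase in modulus. The recursion for the errors is that of
  the denominators, $e_{k+2} = a_{k+2} e_{k+1} + e_k$, and inductively
  $e_k = -x_{k+2} e_{k+1}$ with the complete quotient $x_{k+2}$; so only its fractional part is left.
\<close>

lemma cf_err_Suc:
  "cf_index \<alpha> (Suc k) \<Longrightarrow>
    cf_err \<alpha> (Suc k) = - frac (complete_quot \<alpha> (Suc k)) * cf_err \<alpha> k"
proof (induction k)
  case 0
  hence "frac \<alpha> \<noteq> 0" by (simp add: cf_index_def frac_eq_0_iff)
  thus ?case
    by (simp add: cf_err_def partial_quot_def frac_def field_simps)
next
  case (Suc k)
  define x where "x = complete_quot \<alpha> (Suc k)"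
  define y where "y = complete_quot \<alpha> (Suc (Suc k))"
  have IH: "cf_err \<alpha> (Suc k) = - frac x * cf_err \<alpha> k"
    using Suc.IH cf_index_mono[OF Suc.prems, of "Suc k"] by (simp add: x_def)
  have "x \<notin> \<int>" using Suc.prems unfolding cf_index_def x_def by blast
  hence "frac x \<noteq> 0" by (simp add: frac_eq_0_iff)
  moreover have y: "y = 1 / frac x" by (simp add: x_def y_def)
  ultimately have e: "cf_err \<alpha> k = - y * cf_err \<alpha> (Suc k)" using IH by simp
  have "cf_err \<alpha> (Suc (Suc k)) = of_int \<lfloor>y\<rfloor> * cf_err \<alpha> (Suc k) + cf_err \<alpha> k"
    by (simp add: cf_err_def partial_quot_def y_def algebra_simps)
  also have "\<dots> = - frac y * cf_err \<alpha> (Suc k)" by (subst e) (simp add: frac_def algebra_simps)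
  finally show ?case by (simp add: y_def)
qed

lemma cf_den_le_Suc: "cf_index \<alpha> (Suc k) \<Longrightarrow> cf_den \<alpha> k \<le> cf_den \<alpha> (Suc k)"
proof (cases k)
  case 0
  assume "cf_index \<alpha> (Suc k)"
  thus ?thesis using partial_quot_ge_1[of \<alpha> "Suc k"] 0 by simp
next
  case (Suc j)
  assume k: "cf_index \<alpha> (Suc k)"
  have "0 < cf_den \<alpha> k" "0 < cf_den \<alpha> j"
    using cf_den_pos cf_index_mono[OF k] Suc by auto
  moreover have "1 * cf_den \<alpha> k \<le> partial_quot \<alpha> (Suc k) * cf_den \<alpha> k"
    using partial_quot_ge_1[OF k] \<open>0 < cf_den \<alpha> k\<close> by (intro mult_right_mono) auto
  moreover have "cf_den \<alpha> (Suc k) = partial_quot \<alpha> (Suc k) * cf_den \<alpha> k + cf_den \<alpha> j"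
    using Suc by simp
  ultimately show ?thesis by linarith
qed

text \<open>
  The determinant identity in terms of the errors reads $q_{k+1} e_k - q_k e_{k+1} = \pm 1$, and the second
  product is not larger than the first.
\<close>

lemma cf_err_ge:
  assumes "cf_index \<alpha> (Suc k)"
  shows "1 / (2 * of_int (cf_den \<alpha> (Suc k))) \<le> \<bar>cf_err \<alpha> k\<bar>"
proof -
  let ?q = "real_of_int (cf_den \<alpha> k)" and ?q' = "real_of_int (cf_den \<alpha> (Suc k))"
  have q: "0 < ?q" "?q \<le> ?q'"
    using cf_den_pos[of \<alpha> k] cf_index_mono[OF assms, of k] cf_den_le_Suc[OF assms] by auto
  have "?q' * cf_err \<alpha> k - ?q * cf_err \<alpha> (Suc k)
      = of_int (cf_num \<alpha> (Suc k) * cf_den \<alpha> k - cf_num \<alpha> k * cf_den \<alpha> (Suc k))"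
    by (simp add: cf_err_def algebra_simps)
  also have "\<dots> = (-1) ^ k" unfolding cf_det by simp
  finally have "1 = \<bar>?q' * cf_err \<alpha> k - ?q * cf_err \<alpha> (Suc k)\<bar>" by (simp add: power_abs)
  also have "\<dots> \<le> ?q' * \<bar>cf_err \<alpha> k\<bar> + ?q * \<bar>cf_err \<alpha> (Suc k)\<bar>"
    using q by (intro order.trans[OF abs_triangle_ineq4]) (simp add: abs_mult)
  also have "?q * \<bar>cf_err \<alpha> (Suc k)\<bar> \<le> ?q' * \<bar>cf_err \<alpha> k\<bar>"
  proof (rule mult_mono)
    have "\<bar>cf_err \<alpha> (Suc k)\<bar> = frac (complete_quot \<alpha> (Suc k)) * \<bar>cf_err \<alpha> k\<bar>"
      unfolding cf_err_Suc[OF assms] abs_mult by (simp add: frac_ge_0)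
    also have "\<dots> \<le> 1 * \<bar>cf_err \<alpha> k\<bar>"
      by (intro mult_right_mono) (auto intro: less_imp_le[OF frac_lt_1])
    finally show "\<bar>cf_err \<alpha> (Suc k)\<bar> \<le> \<bar>cf_err \<alpha> k\<bar>" by simp
  qed (use q in auto)
  finally show ?thesis using q by (simp add: field_simps)
qed

text \<open>
  This is the best approximation property of convergents. In the basis of two consecutive convergents,
  $(p,q) = x(p_k,q_k) + y(p_{k-1},q_{k-1})$. Since $0 \le q < q_k$, the coefficients do not have the same sign and
  $y \ne 0$. As $e_k$ and $e_{k-1}$ have opposite signs as well, the contributions to the error of $(p,q)$ cannot cancel,
  so that it is at least $|e_{k-1}|$.
\<close>

lemma approximation_error_ge_below_convergent:
  fixes p q :: int
  assumes k: "cf_index \<alpha> k" and q: "0 \<le> q" "q < cf_den \<alpha> k" and nz: "(p, q) \<noteq> (0, 0)"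
  shows "1 / (2 * of_int (cf_den \<alpha> k)) \<le> \<bar>of_int q * \<alpha> - of_int p\<bar>"
proof (cases k)
  case 0
  hence "q = 0" "p \<noteq> 0" using q nz by auto
  hence "1 \<le> \<bar>p\<bar>" by simp
  hence "(1 :: real) \<le> \<bar>of_int p\<bar>" by linarith
  thus ?thesis using 0 \<open>q = 0\<close> by simp
next
  case (Suc j)
  let ?p0 = "cf_num \<alpha> j" and ?q0 = "cf_den \<alpha> j" and ?p1 = "cf_num \<alpha> k" and ?q1 = "cf_den \<alpha> k"
  have kj: "cf_index \<alpha> (Suc j)" using k Suc by simp
  have den: "0 < ?q0" "0 < ?q1" using cf_den_pos[OF k] cf_den_pos[OF cf_index_mono[OF k, of j]] Suc by auto
  define s :: int where "s = (-1) ^ j"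
  have s: "s * s = 1" by (simp add: s_def flip: power_mult_distrib)
  have det: "?p1 * ?q0 - ?p0 * ?q1 = s" using cf_det[of \<alpha> j] by (simp add: Suc s_def)
  define x where "x = s * (p * ?q0 - q * ?p0)"
  define y where "y = s * (q * ?p1 - p * ?q1)"
  have "x * ?p1 + y * ?p0 = s * p * (?p1 * ?q0 - ?p0 * ?q1)" by (simp add: x_def y_def algebra_simps)
  hence px: "p = x * ?p1 + y * ?p0" unfolding det using s by (simp add: algebra_simps)
  have "x * ?q1 + y * ?q0 = s * q * (?p1 * ?q0 - ?p0 * ?q1)" by (simp add: x_def y_def algebra_simps)
  hence qx: "q = x * ?q1 + y * ?q0" unfolding det using s by (simp add: algebra_simps)
  \<comment> \<open>Otherwise \<open>(p, q)\<close> would be a multiple of the convergent, which is impossible for \<open>q\<close> in this range.\<close>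
  have y0: "y \<noteq> 0"
  proof
    assume "y = 0"
    hence "q = x * ?q1" using qx by simp
    hence "0 \<le> x" "x < 1" using q den by (auto simp: zero_le_mult_iff)
    hence "x = 0" by simp
    thus False using px qx \<open>y = 0\<close> nz by simp
  qed
  have xy: "x * y \<le> 0"
  proof (rule ccontr)
    assume "\<not> x * y \<le> 0"
    hence "(x \<ge> 1 \<and> y \<ge> 1) \<or> (x \<le> -1 \<and> y \<le> -1)" by (auto simp: mult_le_0_iff)
    thus False
    proof
      assume a: "x \<ge> 1 \<and> y \<ge> 1"
      have "1 * ?q1 \<le> x * ?q1" using a den by (intro mult_right_mono) auto
      moreover have "0 \<le> y * ?q0" using a den by simp
      ultimately show False using q qx by linarith
    next
      assume a: "x \<le> -1 \<and> y \<le> -1"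
      have "x * ?q1 < 0" "y * ?q0 < 0" using a den by (auto simp: mult_less_0_iff)
      thus False using q qx by simp
    qed
  qed
  define f where "f = frac (complete_quot \<alpha> k)"
  define e where "e = cf_err \<alpha> j"
  have f: "f \<ge> 0" by (simp add: f_def)
  have e1: "cf_err \<alpha> k = - f * e" using cf_err_Suc[OF kj] by (simp add: f_def e_def Suc)
  have "of_int q * \<alpha> - of_int p = of_int x * cf_err \<alpha> k + of_int y * cf_err \<alpha> j"
    by (subst qx, subst px) (simp add: cf_err_def algebra_simps)
  also have "\<dots> = (of_int y - of_int x * f) * e" by (simp add: e1 e_def algebra_simps)
  finally have eq: "\<bar>of_int q * \<alpha> - of_int p\<bar> = \<bar>of_int y - of_int x * f\<bar> * \<bar>e\<bar>" by (simp add: abs_mult)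
  have "1 \<le> \<bar>of_int y - of_int x * f\<bar>"
  proof (cases "y > 0")
    case True
    hence "x \<le> 0" using xy by (simp add: mult_le_0_iff)
    hence "of_int x * f \<le> 0" using f by (simp add: mult_nonpos_nonneg)
    moreover have "1 \<le> real_of_int y" using True by simp
    ultimately show ?thesis by linarith
  next
    case False
    hence "y \<le> -1" using y0 by simp
    hence "x \<ge> 0" using xy by (simp add: mult_le_0_iff)
    hence "of_int x * f \<ge> 0" using f by simp
    moreover have "real_of_int y \<le> -1" using \<open>y \<le> -1\<close> by linarith
    ultimately show ?thesis by linarith
  qed
  hence "1 * \<bar>e\<bar> \<le> \<bar>of_int q * \<alpha> - of_int p\<bar>" unfolding eq by (rule mult_right_mono) simp
  thus ?thesis using cf_err_ge[OF kj] by (simp add: e_def Suc)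
qed

section \<open>Filling the parallelogram by parallel lattice lines\<close>

text \<open>
  By Cramer's rule, a common divisor of the coordinates divides $a$ and $b$.
\<close>

lemma coprime_unimodular_combination:
  fixes a b p1 q1 p2 q2 :: int
  assumes det: "\<bar>p1 * q2 - q1 * p2\<bar> = 1" and ab: "coprime a b"
  shows "coprime (a * p2 + b * p1) (a * q2 + b * q1)"
proof (rule coprimeI)
  fix d assume d: "d dvd a * p2 + b * p1" "d dvd a * q2 + b * q1"
  have unit: "is_unit (p1 * q2 - q1 * p2)" using det by simp
  have "d dvd (a * q2 + b * q1) * p1 - (a * p2 + b * p1) * q1" using d by simp
  also have "\<dots> = a * (p1 * q2 - q1 * p2)" by (simp add: algebra_simps)
  finally have "d dvd a" using unit by (simp add: dvd_mult_unit_iff)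
  moreover have "d dvd (a * p2 + b * p1) * q2 - (a * q2 + b * q1) * p2" using d by simp
  hence "d dvd b * (p1 * q2 - q1 * p2)" by (simp add: algebra_simps)
  hence "d dvd b" using unit by (simp add: dvd_mult_unit_iff)
  ultimately show "is_unit d" using ab by (meson coprime_common_divisor)
qed

lemma coprime_extend_to_basis:
  fixes p1 q1 s :: int
  assumes "coprime p1 q1"
  obtains p2 q2 where "p1 * q2 - q1 * p2 = s"
proof -
  obtain u v where uv: "u * p1 + v * q1 = 1" using bezout_int[of p1 q1] assms by auto
  have "p1 * (s * u) - q1 * (- s * v) = s * (u * p1 + v * q1)" by (simp add: algebra_simps)
  also have "\<dots> = s" by (simp add: uv)
  finally show thesis by (rule that)
qed

text \<open>
  This reduces the density bound to finding, for every line index $a \in [X,2X]$, an interval of length $L$ of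
  parameters $b$ for which $aw + bu$ lies in $\Sigma$, where $u = (p_1,q_1)$ and $w = (p_2,q_2)$.
  The area equals $8XL$, and at least $XL/200$ of the pairs $(a,b)$ are coprime.
\<close>

lemma dens_ge_of_parallel_lines:
  fixes p1 q1 p2 q2 :: int and X L :: real and c :: "int \<Rightarrow> real"
  assumes "R > 0" "Q > 0" and det: "\<bar>p1 * q2 - q1 * p2\<bar> = 1"
    and X: "1 / 2 \<le> X" "X \<le> 16 * L" and L: "202500 \<le> L" and XL: "X * L = R / (4 * Q)"
    and mem: "\<And>a b. X \<le> of_int a \<Longrightarrow> of_int a \<le> 2 * X \<Longrightarrow> c a \<le> of_int b \<Longrightarrow> of_int b \<le> c a + L \<Longrightarrow>
      (of_int (a * p2 + b * p1), of_int (a * q2 + b * q1)) \<in> parallelogram \<alpha> R Q"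
  shows "1 / 1600 \<le> dens (parallelogram \<alpha> R Q)"
proof -
  let ?S = "{(p :: int, q :: int). (of_int p, of_int q) \<in> parallelogram \<alpha> R Q \<and> gcd p q = 1}"
  let ?T = "{(a :: int, b :: int). X \<le> of_int a \<and> of_int a \<le> 2 * X \<and>
    c a \<le> of_int b \<and> of_int b \<le> c a + L \<and> coprime a b}"
  let ?f = "\<lambda>(a, b). (a * p2 + b * p1, a * q2 + b * q1)"
  have inj: "inj_on ?f ?T"
  proof (rule inj_on_subset[of _ UNIV], rule injI, clarify)
    fix a b a' b' assume eq: "a * p2 + b * p1 = a' * p2 + b' * p1" "a * q2 + b * q1 = a' * q2 + b' * q1"
    have nz: "p1 * q2 - q1 * p2 \<noteq> 0" using det by auto
    have "(a - a') * (p1 * q2 - q1 * p2) = 0" "(b - b') * (p1 * q2 - q1 * p2) = 0"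
      using eq by algebra+
    thus "a = a' \<and> b = b'" using nz by simp
  qed simp
  have sub: "?f ` ?T \<subseteq> ?S"
    using mem coprime_unimodular_combination[OF det] by (auto simp: coprime_iff_gcd_eq_1)
  have "card ?T = card (?f ` ?T)" by (rule card_image[OF inj, symmetric])
  also have "\<dots> \<le> card ?S" by (rule card_mono[OF finite_lattice_points_parallelogram sub])
  finally have "X * L / 200 \<le> real (card ?S)" using card_coprime_pairs_ge[OF X L, of c] by linarith
  moreover have "area (parallelogram \<alpha> R Q) = 8 * (X * L)"
    using assms(1,2) XL by (simp add: area_parallelogram)
  moreover have "X * L > 0" using assms(1,2) XL by simp
  ultimately show ?thesis by (simp add: dens_def field_simps)
qed

text \<open>
  In a steep direction the lines are parametrised by their height $y$. With
  $e_1 = q_1\alpha - p_1$, the point of the $a$-th line at height $y$ has error $(\pm a + e_1 y)/q_1$.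
  The sign is free, as the second basis vector may be negated; choosing it opposite to that of
  $e_1$ makes the two terms work against each other. For $a/q_1 \in [1/(2Q), 1/Q]$ and
  $y \in [R, \frac32 R]$, the second term is at most $3/(4Q)$ in modulus, so the error does not exceed $1/Q$.
  Steepness is what bounds the second term, and $q_1 \ge Q$ ensures that the range of $a$ has $X \ge 1/2$.
\<close>

lemma dens_ge_steep_direction:
  fixes p1 q1 :: int
  assumes RQ: "R > 0" "Q > 0" "1620000\<^sup>2 * Q \<le> R" and cop: "coprime p1 q1"
    and steep: "2 * R * Q * \<bar>of_int q1 * \<alpha> - of_int p1\<bar> \<le> of_int q1"
    and large: "Q \<le> of_int q1" and small: "(of_int q1)\<^sup>2 \<le> R * Q"
  shows "1 / 1600 \<le> dens (parallelogram \<alpha> R Q)"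
proof -
  define e1 where "e1 = of_int q1 * \<alpha> - of_int p1"
  define s :: int where "s = (if e1 > 0 then -1 else 1)"
  obtain p2 q2 where det: "p1 * q2 - q1 * p2 = s" using coprime_extend_to_basis[OF cop] .
  define e2 where "e2 = of_int q2 * \<alpha> - of_int p2"
  let ?q = "real_of_int q1"
  have q: "?q > 0" using large RQ by linarith
  define X where "X = ?q / (2 * Q)"
  define L where "L = R / (2 * ?q)"
  have det': "e2 * ?q - e1 * of_int q2 = of_int s"
    unfolding det[symmetric] e1_def e2_def by (simp add: algebra_simps)
  show ?thesis
  proof (rule dens_ge_of_parallel_lines[OF RQ(1,2), of p1 q2 q1 p2 X L "\<lambda>a. (R - of_int a * of_int q2) / ?q"])
    show "\<bar>p1 * q2 - q1 * p2\<bar> = 1" by (simp add: det s_def)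
    show "1 / 2 \<le> X" using large RQ by (simp add: X_def field_simps)
    have "0 \<le> R * Q" using RQ by simp
    hence "?q * ?q \<le> R * Q * 16" using small unfolding power2_eq_square by linarith
    thus "X \<le> 16 * L" using q RQ by (simp add: X_def L_def field_simps)
    \<comment> \<open>$L = R/(2q_1)$ is of order at least $\sqrt{R/Q}$, so it is large when the area is.\<close>
    have "(1620000 * ?q)\<^sup>2 \<le> 1620000\<^sup>2 * (R * Q)" using small by (simp add: power_mult_distrib)
    also have "\<dots> \<le> R\<^sup>2" using mult_left_mono[OF RQ(3), of R] RQ(1) by (simp add: power2_eq_square mult_ac)
    finally have "1620000 * ?q \<le> R" by (rule power2_le_imp_le) (use RQ in simp)
    thus "202500 \<le> L" using q by (simp add: L_def field_simps)
    show "X * L = R / (4 * Q)" using q RQ by (simp add: X_def L_def field_simps)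
  next
    fix a b :: int
    assume a: "X \<le> of_int a" "of_int a \<le> 2 * X"
      and b: "(R - of_int a * of_int q2) / ?q \<le> of_int b"
        "of_int b \<le> (R - of_int a * of_int q2) / ?q + L"
    define y where "y = of_int a * of_int q2 + of_int b * ?q"
    have y: "R \<le> y" "y \<le> 3 / 2 * R" using b q by (simp_all add: y_def L_def field_simps)
    define e where "e = of_int a * e2 + of_int b * e1"
    have e: "?q * e = of_int s * of_int a + e1 * y"
      unfolding det'[symmetric] by (simp add: e_def y_def algebra_simps)
    have "\<bar>e1\<bar> * y \<le> ?q / (2 * R * Q) * (3 / 2 * R)"
      using steep y RQ q by (intro mult_mono) (auto simp: e1_def field_simps)
    also have "\<dots> \<le> 3 / 4 * (?q / Q)" using RQ by (simp add: field_simps)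
    finally have ey: "\<bar>e1\<bar> * y \<le> 3 / 4 * (?q / Q)" .
    have ey0: "0 \<le> \<bar>e1\<bar> * y" using y RQ by simp
    have aX: "1 / 2 * (?q / Q) \<le> of_int a" "of_int a \<le> ?q / Q" using a by (simp_all add: X_def)
    \<comment> \<open>The sign \<open>s\<close> was chosen for this cancellation.\<close>
    have "\<bar>?q * e\<bar> = \<bar>of_int a - \<bar>e1\<bar> * y\<bar>" unfolding e by (auto simp: s_def)
    also have "\<dots> \<le> ?q / Q" using ey ey0 aX by linarith
    finally have "?q * \<bar>e\<bar> \<le> ?q * (1 / Q)" using q by (simp add: abs_mult)
    hence "\<bar>e\<bar> \<le> 1 / Q" using q by (simp only: mult_le_cancel_left_pos)
    moreover have "e = of_int (a * q2 + b * q1) * \<alpha> - of_int (a * p2 + b * p1)"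
      by (simp add: e_def e1_def e2_def algebra_simps)
    moreover have "y = of_int (a * q2 + b * q1)" by (simp add: y_def)
    ultimately show "(of_int (a * p2 + b * p1), of_int (a * q2 + b * q1)) \<in> parallelogram \<alpha> R Q"
      using y RQ by (simp add: parallelogram_def)
  qed
qed

text \<open>
  In a flat direction the lines are parametrised by the error. With $e_1 = q_1\alpha - p_1$ and the proper sign of
  the second basis vector, the $a$-th line meets the axis $e = 0$ at height $h = a/|e_1|$, at the
  real parameter $b = b_0$. Taking $a \in [X,2X]$ with $X = R|e_1|$ is the same as $h \in [R,2R]$.
  Moving $b$ by at most $L = 1/(4Q|e_1|)$ changes the error by at most $1/(4Q)$ and, the direction being flat, the height
  by at most $R/2$. To stay in $[R,2R]$, the height has to increase from the lower half and to decrease from the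
  upper half.
\<close>

lemma dens_ge_flat_direction:
  fixes p1 q1 :: int
  assumes RQ: "R > 0" "Q > 0" "1620000\<^sup>2 * Q \<le> R" and cop: "coprime p1 q1" "q1 \<ge> 0"
    and flat: "of_int q1 \<le> 2 * R * Q * \<bar>of_int q1 * \<alpha> - of_int p1\<bar>"
    and large: "1 \<le> 2 * R * \<bar>of_int q1 * \<alpha> - of_int p1\<bar>"
    and small: "R * Q * (of_int q1 * \<alpha> - of_int p1)\<^sup>2 \<le> 4"
  shows "1 / 1600 \<le> dens (parallelogram \<alpha> R Q)"
proof -
  define e1 where "e1 = of_int q1 * \<alpha> - of_int p1"
  define s :: int where "s = (if e1 > 0 then -1 else 1)"
  obtain p2 q2 where det: "p1 * q2 - q1 * p2 = s" using coprime_extend_to_basis[OF cop(1)] .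
  define e2 where "e2 = of_int q2 * \<alpha> - of_int p2"
  let ?q = "real_of_int q1"
  have e0: "e1 \<noteq> 0" using large by (auto simp: e1_def)
  define X where "X = R * \<bar>e1\<bar>"
  define L where "L = 1 / (4 * Q * \<bar>e1\<bar>)"
  define b0 where "b0 = (\<lambda>a :: int. - of_int a * e2 / e1)"
  define c where "c = (\<lambda>a. if of_int a / \<bar>e1\<bar> \<le> 3 / 2 * R then b0 a else b0 a - L)"
  have det': "e2 * ?q - e1 * of_int q2 = of_int s"
    unfolding det[symmetric] e1_def e2_def by (simp add: algebra_simps)
  have L0: "L > 0" using e0 RQ by (simp add: L_def)
  show ?thesis
  proof (rule dens_ge_of_parallel_lines[OF RQ(1,2), of p1 q2 q1 p2 X L c])
    show "\<bar>p1 * q2 - q1 * p2\<bar> = 1" by (simp add: det s_def)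
    show "1 / 2 \<le> X" using large by (simp add: X_def e1_def)
    have "R * Q * (\<bar>e1\<bar> * \<bar>e1\<bar>) \<le> 4" using small by (simp add: e1_def power2_eq_square)
    thus "X \<le> 16 * L" using e0 RQ by (simp add: X_def L_def field_simps)
    \<comment> \<open>Here $|e_1| \le 2/\sqrt{RQ}$ gives $L \ge \sqrt{R/Q}/8$, and $1620000/8 = 202500$.\<close>
    have "(1620000 * (Q * \<bar>e1\<bar>))\<^sup>2 = (1620000\<^sup>2 * Q) * (Q * e1\<^sup>2)"
      by (simp add: power_mult_distrib power2_eq_square)
    also have "\<dots> \<le> R * (Q * e1\<^sup>2)" using RQ by (intro mult_right_mono) auto
    also have "\<dots> \<le> 2\<^sup>2" using small by (simp add: e1_def mult.assoc)
    finally have "1620000 * (Q * \<bar>e1\<bar>) \<le> 2" by (rule power2_le_imp_le) simp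
    thus "202500 \<le> L" using e0 RQ by (simp add: L_def field_simps)
    show "X * L = R / (4 * Q)" using e0 RQ by (simp add: X_def L_def field_simps)
  next
    fix a b :: int
    assume a: "X \<le> of_int a" "of_int a \<le> 2 * X" and b: "c a \<le> of_int b" "of_int b \<le> c a + L"
    define d where "d = of_int b - b0 a"
    define h where "h = of_int a / \<bar>e1\<bar>"
    define y where "y = of_int a * of_int q2 + of_int b * ?q"
    define e where "e = of_int a * e2 + of_int b * e1"
    have h: "R \<le> h" "h \<le> 2 * R" using a e0 by (simp_all add: h_def X_def field_simps)
    have e: "e = d * e1" using e0 by (simp add: e_def d_def b0_def field_simps)
    have "y * e1 = - of_int s * of_int a + ?q * d * e1"
      unfolding det'[symmetric] using e0 by (simp add: y_def d_def b0_def field_simps)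
    also have "- of_int s * of_int a = h * e1" using e0 by (auto simp: s_def h_def)
    finally have "y * e1 = (h + ?q * d) * e1" by (simp add: algebra_simps)
    hence y: "y = h + ?q * d" using e0 by simp
    have d: "if h \<le> 3 / 2 * R then 0 \<le> d \<and> d \<le> L else - L \<le> d \<and> d \<le> 0"
      using b by (auto simp: c_def d_def h_def)
    have qL: "?q * L \<le> R / 2" using flat e0 RQ by (simp add: L_def e1_def field_simps)
    have "R \<le> y \<and> y \<le> 2 * R"
    proof (cases "h \<le> 3 / 2 * R")
      case True
      hence "0 \<le> ?q * d" "?q * d \<le> ?q * L" using d cop(2) by (auto intro: mult_left_mono)
      thus ?thesis using True qL h y by linarith
    next
      case False
      hence d': "d \<le> 0" "- d \<le> L" using d by auto
      have "?q * d \<le> 0" "?q * (- d) \<le> ?q * L"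
        using d'(1) cop(2) mult_left_mono[OF d'(2), of ?q] by (simp_all add: mult_nonneg_nonpos)
      thus ?thesis using False qL h y by simp
    qed
    moreover have "\<bar>d\<bar> \<le> L" using d L0 by (auto split: if_splits)
    hence "\<bar>e\<bar> \<le> L * \<bar>e1\<bar>" unfolding e abs_mult by (rule mult_right_mono) simp
    hence "\<bar>e\<bar> \<le> 1 / Q" using e0 RQ by (simp add: L_def field_simps)
    moreover have "e = of_int (a * q2 + b * q1) * \<alpha> - of_int (a * p2 + b * p1)"
      by (simp add: e_def e1_def e2_def algebra_simps)
    moreover have "y = of_int (a * q2 + b * q1)" by (simp add: y_def)
    ultimately show "(of_int (a * p2 + b * p1), of_int (a * q2 + b * q1)) \<in> parallelogram \<alpha> R Q"
      by (simp add: parallelogram_def)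
  qed
qed

section \<open>Choice of the direction\<close>

text \<open>
  Both coordinates of this vector have length $O(\sqrt\delta)$ after scaling, with $T = RQ$. For $T < 1$ Dirichlet's theorem is
  void, and the horizontal vector $(1,0)$ of error $-1$ is short enough.
\<close>

lemma exists_short_primitive_vector:
  fixes \<alpha> T :: real
  assumes "T > 0"
  obtains p q :: int where "coprime p q" "0 \<le> q" "(of_int q)\<^sup>2 \<le> T" "T * (of_int q * \<alpha> - of_int p)\<^sup>2 \<le> 4"
proof (cases "T \<ge> 1")
  case False
  show thesis by (rule that[of 1 0]) (use False assms in auto)
next
  case True
  define N where "N = nat \<lfloor>sqrt T\<rfloor>"
  have "sqrt T \<ge> 1" using True by simp
  hence "\<lfloor>sqrt T\<rfloor> \<ge> 1" by simp
  hence "N > 0" "real N = of_int \<lfloor>sqrt T\<rfloor>" "(1 :: real) \<le> of_int \<lfloor>sqrt T\<rfloor>" by (simp_all add: N_def)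
  moreover have "of_int \<lfloor>sqrt T\<rfloor> \<le> sqrt T" "sqrt T < of_int \<lfloor>sqrt T\<rfloor> + 1" by linarith+
  ultimately have N: "N > 0" "real N \<le> sqrt T" "sqrt T \<le> 2 * real N" by linarith+
  obtain p q where pq: "coprime p q" "0 < q" "q \<le> int N" "\<bar>of_int q * \<alpha> - of_int p\<bar> < 1 / real N"
    using Dirichlet_approx_coprime[OF N(1), of \<alpha>] by metis
  show thesis
  proof (rule that[OF pq(1)])
    have "real_of_int q \<le> sqrt T" using pq(3) N(2) by linarith
    hence "(of_int q)\<^sup>2 \<le> (sqrt T)\<^sup>2" using pq(2) by (intro power_mono) auto
    thus "(of_int q)\<^sup>2 \<le> T" using True by simp
    have "sqrt T * \<bar>of_int q * \<alpha> - of_int p\<bar> \<le> (2 * real N) * (1 / real N)"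
      using N pq(4) True by (intro mult_mono) auto
    hence "(sqrt T * \<bar>of_int q * \<alpha> - of_int p\<bar>)\<^sup>2 \<le> 2\<^sup>2"
      using N True by (intro power_mono) auto
    thus "T * (of_int q * \<alpha> - of_int p)\<^sup>2 \<le> 4" using True by (simp add: power_mult_distrib)
  qed (use pq in auto)
qed

theorem theorem3:
  "\<exists>(A\<^sub>0 :: real) (\<rho>\<^sub>0 :: real). \<rho>\<^sub>0 > 0 \<and>
     (\<forall>(\<alpha> :: real) (R :: real) (Q :: real). R > 0 \<longrightarrow> Q > 0 \<longrightarrow>
        area (parallelogram \<alpha> R Q) \<ge> A\<^sub>0 \<longrightarrow>
        real_of_int ` Spec \<alpha> \<inter> {Q..R} \<noteq> {} \<longrightarrow>
        dens (parallelogram \<alpha> R Q) \<ge> \<rho>\<^sub>0)"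
proof (rule exI[of _ "2 * 1620000\<^sup>2"], rule exI[of _ "1 / 1600"], intro conjI allI impI)
  fix \<alpha> R Q :: real
  assume RQ: "R > 0" "Q > 0" and area: "area (parallelogram \<alpha> R Q) \<ge> 2 * 1620000\<^sup>2"
    and spec: "real_of_int ` Spec \<alpha> \<inter> {Q..R} \<noteq> {}"
  have KRQ: "1620000\<^sup>2 * Q \<le> R" using area RQ by (simp add: area_parallelogram field_simps)
  obtain k where k: "cf_index \<alpha> k" "Q \<le> of_int (cf_den \<alpha> k)" "of_int (cf_den \<alpha> k) \<le> R"
    using spec by (auto simp: Spec_def height_convergent_of)
  obtain p q :: int where pq: "coprime p q" "0 \<le> q" "(of_int q)\<^sup>2 \<le> R * Q"
      "R * Q * (of_int q * \<alpha> - of_int p)\<^sup>2 \<le> 4"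
    using exists_short_primitive_vector[of "R * Q" \<alpha>] RQ by auto
  define e where "e = \<bar>of_int q * \<alpha> - of_int p\<bar>"
  \<comment> \<open>The short vector is not much shorter than $\delta = Q/R$ in the scaled coordinates $(Qe, q/R)$.\<close>
  have dich: "Q \<le> of_int q \<or> 1 \<le> 2 * R * e"
  proof (cases "q < cf_den \<alpha> k")
    case True
    have "(p, q) \<noteq> (0, 0)" using pq(1) by auto
    hence "1 / (2 * of_int (cf_den \<alpha> k)) \<le> e"
      unfolding e_def by (intro approximation_error_ge_below_convergent k(1) pq(2) True)
    moreover have "1 / (2 * R) \<le> 1 / (2 * of_int (cf_den \<alpha> k))"
      using k RQ by (intro divide_left_mono) auto
    ultimately have "1 / (2 * R) \<le> e" by linarith
    thus ?thesis using RQ by (simp add: field_simps)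
  next
    case False
    hence "real_of_int (cf_den \<alpha> k) \<le> of_int q" by simp
    thus ?thesis using k(2) by linarith
  qed
  show "1 / 1600 \<le> dens (parallelogram \<alpha> R Q)"
  proof (cases "2 * R * Q * e \<le> of_int q")
    case True
    have "Q \<le> of_int q"
      using dich
    proof
      assume "1 \<le> 2 * R * e"
      hence "Q * 1 \<le> Q * (2 * R * e)" using RQ by (intro mult_left_mono) auto
      thus ?thesis using True by (simp add: mult_ac)
    qed
    thus ?thesis using dens_ge_steep_direction[OF RQ KRQ pq(1)] True pq(3) by (simp add: e_def)
  next
    case False
    have "1 \<le> 2 * R * e"
      using dich
    proof
      assume "Q \<le> of_int q"
      hence "Q * 1 \<le> Q * (2 * R * e)" using False by (simp add: mult_ac)
      thus ?thesis using RQ by (simp only: mult_le_cancel_left_pos)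
    qed
    thus ?thesis using dens_ge_flat_direction[OF RQ KRQ pq(1,2)] False pq(4) by (simp add: e_def)
  qed
qed simp

end
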